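(* Let $N$ be a compact domain with smooth boundary in a hyperbolic 3-manifold, let $W(N)=V(N)-\frac14\int_{\partial N}H\,da$, and let $\pi=-\frac14\big(I\!I-\frac H2 I\big)$ on $\partial N$. Define the Legendre-dual $W$-volume by $${}^*W(N):=-\int_{\partial N}\langle\pi,I\rangle\,da+W(N).$$ Then the $W$-volume is self-dual: ${}^*W(N)=W(N)$.
   Context: $V(N)$ is the hyperbolic volume of $N$; $I$ is the induced metric on $\partial N$, $B$ its shape operator, $I\!I(x,y)=I(Bx,y)$ the second fundamental form, $H=\mathrm{tr}\,B$, and $da$ the area form of $I$. For symmetric bilinear forms $A,A'$ on $\partial N$, $\langle A,A'\rangle=\mathrm{tr}(I^{-1}A\,I^{-1}A')$, where $I^{-1}A$ is the endomorphism $b$ with $A(x,y)=I(bx,y)$. *)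

theory Defs
  imports "HOL-Analysis.Analysis"
begin

section \<open>Smooth maps\<close>

text \<open>For open \<open>S\<close>, \<open>Ck_on k f S\<close> says that \<open>f\<close> is of class \<open>C\<^sup>k\<close> on \<open>S\<close>.\<close>

primrec Ck_on ::
  "nat \<Rightarrow> ('a::euclidean_space \<Rightarrow> 'b::real_normed_vector) \<Rightarrow> 'a set \<Rightarrow> bool" where
  "Ck_on 0 f S \<longleftrightarrow> continuous_on S f"
| "Ck_on (Suc k) f S \<longleftrightarrow>
     f differentiable_on S \<and> (\<forall>v. Ck_on k (\<lambda>x. frechet_derivative f (at x) v) S)"

definition smooth_on ::
  "'a::euclidean_space set \<Rightarrow> ('a \<Rightarrow> 'b::real_normed_vector) \<Rightarrow> bool" where
  "smooth_on S f \<longleftrightarrow> (\<forall>k. Ck_on k f S)"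


section \<open>Hyperbolic space: the upper half-space model\<close>

definition hyp_space :: "(real^3) set" where
  "hyp_space = {x. x$3 > 0}"

definition hyp_metric :: "real^3 \<Rightarrow> real^3 \<Rightarrow> real^3 \<Rightarrow> real" where
  "hyp_metric x u v = (u \<bullet> v) / (x$3)\<^sup>2"

definition hyp_christoffel :: "real^3 \<Rightarrow> real^3 \<Rightarrow> real^3 \<Rightarrow> real^3" where
  "hyp_christoffel x u v =
     - (1 / x$3) *\<^sub>R ((u$3) *\<^sub>R v + (v$3) *\<^sub>R u - (u \<bullet> v) *\<^sub>R axis 3 1)"

text \<open>
  The next two lemmas (no torsion, compatibility with the metric) identify the connection with
  these Christoffel symbols as the Levi-Civita connection.\<close>

lemma hyp_christoffel_sym: "hyp_christoffel x u v = hyp_christoffel x v u"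
  by (simp add: hyp_christoffel_def inner_commute add.commute)

lemma hyp_christoffel_metric:
  assumes "x \<in> hyp_space"
  shows "((\<lambda>y. hyp_metric y v w) has_derivative
          (\<lambda>u. hyp_metric x (hyp_christoffel x u v) w + hyp_metric x v (hyp_christoffel x u w)))
         (at x)"
proof -
  have x: "x$3 > 0" using assms by (simp add: hyp_space_def)
  have nth: "((\<lambda>y. y$3) has_derivative (\<lambda>u. u$3)) (at x)"
    by (rule bounded_linear_imp_has_derivative[OF bounded_linear_vec_nth])
  have "((\<lambda>y. (v \<bullet> w) / (y$3)\<^sup>2) has_derivative
         (\<lambda>u. (v \<bullet> w) * (- 2 * u$3 / (x$3)^3))) (at x)"
    by (rule derivative_eq_intros nth refl)+
      (use x in \<open>auto simp: field_simps power2_eq_square power3_eq_cube fun_eq_iff\<close>)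
  moreover have "(v \<bullet> w) * (- 2 * u$3 / (x$3)^3) =
      hyp_metric x (hyp_christoffel x u v) w + hyp_metric x v (hyp_christoffel x u w)" for u
    using x by (simp add: hyp_metric_def hyp_christoffel_def inner_diff_left inner_diff_right
        inner_add_left inner_add_right inner_axis inner_axis' inner_commute[of v u]
        inner_commute[of w u] field_simps power2_eq_square power3_eq_cube)
  ultimately show ?thesis
    by (simp add: hyp_metric_def)
qed

definition hyp_covariant :: "(real^3 \<Rightarrow> real^3) \<Rightarrow> real^3 \<Rightarrow> real^3 \<Rightarrow> real^3" where
  "hyp_covariant X x u = frechet_derivative X (at x) u + hyp_christoffel x u (X x)"

definition hyp_gradient :: "(real^3 \<Rightarrow> real) \<Rightarrow> real^3 \<Rightarrow> real^3" where
  "hyp_gradient f x = (THE w. \<forall>v. hyp_metric x w v = frechet_derivative f (at x) v)"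


section \<open>Hyperbolic 3-manifolds\<close>

text \<open>
  A hyperbolic 3-manifold is given by charts to hyperbolic space with isometric transition maps.
  It is the open subset \<open>M\<close> of the ambient space covered by the charts.\<close>

type_synonym 'm hyp_chart = "'m set \<times> ('m \<Rightarrow> real^3)"

definition transition ::
  "'m hyp_chart \<Rightarrow> 'm hyp_chart \<Rightarrow> real^3 \<Rightarrow> real^3" where
  "transition c d = snd d \<circ> inv_into (fst c) (snd c)"

definition hyperbolic_3_manifold ::
  "'m::{t2_space,second_countable_topology} set \<Rightarrow> 'm hyp_chart set \<Rightarrow> bool" where
  "hyperbolic_3_manifold M \<A> \<longleftrightarrow>
     M = (\<Union>(U, \<phi>)\<in>\<A>. U) \<and>
     (\<forall>(U, \<phi>)\<in>\<A>. open U \<and> open (\<phi> ` U) \<and> \<phi> ` U \<subseteq> hyp_space \<and>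
        homeomorphism U (\<phi> ` U) \<phi> (inv_into U \<phi>)) \<and>
     (\<forall>c\<in>\<A>. \<forall>d\<in>\<A>.
        smooth_on (snd c ` (fst c \<inter> fst d)) (transition c d) \<and>
        (\<forall>x \<in> snd c ` (fst c \<inter> fst d). \<forall>u v.
           hyp_metric (transition c d x)
             (frechet_derivative (transition c d) (at x) u)
             (frechet_derivative (transition c d) (at x) v) = hyp_metric x u v))"


section \<open>Riemannian measures\<close>

definition local_parametrization ::
  "'m hyp_chart \<Rightarrow> 'm set \<Rightarrow> (real^'k::finite) set \<Rightarrow> (real^'k \<Rightarrow> real^3) \<Rightarrow> bool" where
  "local_parametrization c S D \<psi> \<longleftrightarrow>
     open D \<and> smooth_on D \<psi> \<and> inj_on \<psi> D \<and>
     (\<forall>x\<in>D. inj (frechet_derivative \<psi> (at x))) \<and>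
     \<psi> ` D \<subseteq> snd c ` (S \<inter> fst c)"

definition volume_density :: "(real^'k::finite \<Rightarrow> real^3) \<Rightarrow> real^'k \<Rightarrow> real" where
  "volume_density \<psi> x =
     sqrt (det ((\<chi> i j. hyp_metric (\<psi> x)
       (frechet_derivative \<psi> (at x) (axis i 1))
       (frechet_derivative \<psi> (at x) (axis j 1))) :: real^'k^'k))"

text \<open>
  The measure induced by the hyperbolic metric on a submanifold \<open>S\<close> of dimension \<open>CARD('k)\<close>: the
  Borel measure on \<open>S\<close> that has density \<open>sqrt (det g)\<close> in every local parametrization.
  Since \<open>S\<close> is covered by countably many of these, there is exactly one such measure.\<close>

definition riemannian_measure ::
  "'m::{t2_space,second_countable_topology} hyp_chart set \<Rightarrow> 'm set \<Rightarrow>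
   (real^'k::finite) itself \<Rightarrow> 'm measure" where
  "riemannian_measure \<A> S _ =
     (THE \<mu>. sets \<mu> = sets (restrict_space borel S) \<and>
       (\<forall>c\<in>\<A>. \<forall>D. \<forall>\<psi> :: real^'k \<Rightarrow> real^3. local_parametrization c S D \<psi> \<longrightarrow>
         (\<forall>E\<in>sets borel. E \<subseteq> D \<longrightarrow>
           emeasure \<mu> (inv_into (fst c) (snd c) ` \<psi> ` E) =
           (\<integral>\<^sup>+x\<in>E. ennreal (volume_density \<psi> x) \<partial>lborel))))"


section \<open>Compact domains with smooth boundary\<close>

text \<open>
  Near the boundary point \<open>p\<close>, the domain \<open>N\<close> is, in the chart \<open>(U, \<phi>)\<close> and on the open set \<open>Q\<close>,
  the sublevel set \<open>f \<le> 0\<close> of a submersion.\<close>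

fun boundary_description ::
  "'m hyp_chart set \<Rightarrow> 'm set \<Rightarrow> 'm \<Rightarrow>
   'm set \<times> ('m \<Rightarrow> real^3) \<times> (real^3) set \<times> (real^3 \<Rightarrow> real) \<Rightarrow> bool" where
  "boundary_description \<A> N p (U, \<phi>, Q, f) \<longleftrightarrow>
     (U, \<phi>) \<in> \<A> \<and> p \<in> U \<and> open Q \<and> \<phi> p \<in> Q \<and> Q \<subseteq> \<phi> ` U \<and> smooth_on Q f \<and>
     (\<forall>x\<in>Q. \<exists>v. frechet_derivative f (at x) v \<noteq> 0) \<and>
     (\<forall>x\<in>Q. inv_into U \<phi> x \<in> N \<longleftrightarrow> f x \<le> 0)"

definition compact_smooth_domain ::
  "'m::{t2_space,second_countable_topology} set \<Rightarrow> 'm hyp_chart set \<Rightarrow> 'm set \<Rightarrow> bool" where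
  "compact_smooth_domain M \<A> N \<longleftrightarrow>
     compact N \<and> N \<subseteq> M \<and> (\<forall>p\<in>frontier N. \<exists>d. boundary_description \<A> N p d)"

text \<open>
  Tensors on \<open>\<partial>N\<close> at \<open>p\<close> are computed in one chosen description of the boundary. The tangent space
  of \<open>M\<close> at \<open>p\<close> is identified with \<open>real^3\<close> by the chart, and all the scalars obtained below are
  independent of the choice, because transition maps are isometries.\<close>

definition chosen_description ::
  "'m hyp_chart set \<Rightarrow> 'm set \<Rightarrow> 'm \<Rightarrow>
   'm set \<times> ('m \<Rightarrow> real^3) \<times> (real^3) set \<times> (real^3 \<Rightarrow> real)" where
  "chosen_description \<A> N p = (SOME d. boundary_description \<A> N p d)"

definition boundary_position :: "'m hyp_chart set \<Rightarrow> 'm set \<Rightarrow> 'm \<Rightarrow> real^3" where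
  "boundary_position \<A> N p = (case chosen_description \<A> N p of (U, \<phi>, Q, f) \<Rightarrow> \<phi> p)"

definition defining_function :: "'m hyp_chart set \<Rightarrow> 'm set \<Rightarrow> 'm \<Rightarrow> real^3 \<Rightarrow> real" where
  "defining_function \<A> N p = (case chosen_description \<A> N p of (U, \<phi>, Q, f) \<Rightarrow> f)"

definition boundary_tangent :: "'m hyp_chart set \<Rightarrow> 'm set \<Rightarrow> 'm \<Rightarrow> (real^3) set" where
  "boundary_tangent \<A> N p =
     {u. frechet_derivative (defining_function \<A> N p) (at (boundary_position \<A> N p)) u = 0}"

text \<open>Since \<open>f \<le> 0\<close> in \<open>N\<close>, this is the outward unit normal, extended off the boundary.\<close>

definition unit_normal ::
  "'m hyp_chart set \<Rightarrow> 'm set \<Rightarrow> 'm \<Rightarrow> real^3 \<Rightarrow> real^3" where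
  "unit_normal \<A> N p x =
     (let w = hyp_gradient (defining_function \<A> N p) x in (1 / sqrt (hyp_metric x w w)) *\<^sub>R w)"


section \<open>Bilinear forms on the boundary\<close>

definition trace_on :: "'a::real_vector set \<Rightarrow> ('a \<Rightarrow> 'a) \<Rightarrow> real" where
  "trace_on T b =
     (let E = (SOME E. independent E \<and> span E = T) in \<Sum>e\<in>E. representation E (b e) e)"

definition first_form :: "'m hyp_chart set \<Rightarrow> 'm set \<Rightarrow> 'm \<Rightarrow> real^3 \<Rightarrow> real^3 \<Rightarrow> real" where
  "first_form \<A> N p u v = hyp_metric (boundary_position \<A> N p) u v"

text \<open>With this sign, the shape operator of a convex domain is nonnegative.\<close>

definition shape_operator :: "'m hyp_chart set \<Rightarrow> 'm set \<Rightarrow> 'm \<Rightarrow> real^3 \<Rightarrow> real^3" where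
  "shape_operator \<A> N p u = hyp_covariant (unit_normal \<A> N p) (boundary_position \<A> N p) u"

definition second_form :: "'m hyp_chart set \<Rightarrow> 'm set \<Rightarrow> 'm \<Rightarrow> real^3 \<Rightarrow> real^3 \<Rightarrow> real" where
  "second_form \<A> N p u v = first_form \<A> N p (shape_operator \<A> N p u) v"

definition mean_curvature :: "'m hyp_chart set \<Rightarrow> 'm set \<Rightarrow> 'm \<Rightarrow> real" where
  "mean_curvature \<A> N p = trace_on (boundary_tangent \<A> N p) (shape_operator \<A> N p)"

definition momentum_form :: "'m hyp_chart set \<Rightarrow> 'm set \<Rightarrow> 'm \<Rightarrow> real^3 \<Rightarrow> real^3 \<Rightarrow> real" where
  "momentum_form \<A> N p u v =
     - (1/4) * (second_form \<A> N p u v - mean_curvature \<A> N p / 2 * first_form \<A> N p u v)"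

text \<open>The endomorphism \<open>I\<^sup>-\<^sup>1A\<close> of the tangent plane of the boundary.\<close>

definition form_endo ::
  "'m hyp_chart set \<Rightarrow> 'm set \<Rightarrow> 'm \<Rightarrow> (real^3 \<Rightarrow> real^3 \<Rightarrow> real) \<Rightarrow> real^3 \<Rightarrow> real^3" where
  "form_endo \<A> N p A u =
     (THE z. z \<in> boundary_tangent \<A> N p \<and>
       (\<forall>v\<in>boundary_tangent \<A> N p. A u v = first_form \<A> N p z v))"

definition form_inner ::
  "'m hyp_chart set \<Rightarrow> 'm set \<Rightarrow> 'm \<Rightarrow>
   (real^3 \<Rightarrow> real^3 \<Rightarrow> real) \<Rightarrow> (real^3 \<Rightarrow> real^3 \<Rightarrow> real) \<Rightarrow> real" where
  "form_inner \<A> N p A A' =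
     trace_on (boundary_tangent \<A> N p) (form_endo \<A> N p A \<circ> form_endo \<A> N p A')"


section \<open>The W-volume and its Legendre dual\<close>

definition hyp_volume ::
  "'m::{t2_space,second_countable_topology} set \<Rightarrow> 'm hyp_chart set \<Rightarrow> 'm set \<Rightarrow> real" where
  "hyp_volume M \<A> N = measure (riemannian_measure \<A> M TYPE(real^3)) N"

definition boundary_area ::
  "'m::{t2_space,second_countable_topology} hyp_chart set \<Rightarrow> 'm set \<Rightarrow> 'm measure" where
  "boundary_area \<A> N = riemannian_measure \<A> (frontier N) TYPE(real^2)"

definition W_volume ::
  "'m::{t2_space,second_countable_topology} set \<Rightarrow> 'm hyp_chart set \<Rightarrow> 'm set \<Rightarrow> real" where
  "W_volume M \<A> N =
     hyp_volume M \<A> N - 1/4 * (LINT p:frontier N|boundary_area \<A> N. mean_curvature \<A> N p)"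

definition dual_W_volume ::
  "'m::{t2_space,second_countable_topology} set \<Rightarrow> 'm hyp_chart set \<Rightarrow> 'm set \<Rightarrow> real" where
  "dual_W_volume M \<A> N =
     - (LINT p:frontier N|boundary_area \<A> N.
          form_inner \<A> N p (momentum_form \<A> N p) (first_form \<A> N p))
     + W_volume M \<A> N"

end

(* With respect to I, the endomorphism associated with I is the identity of the tangent plane and
   the one associated with pi is -(1/4) (B - (H/2) id), whose trace is -(1/4) (H - (H/2) 2) = 0
   because the boundary has dimension 2. So the integrand <pi, I> vanishes pointwise. That B maps
   the tangent plane to itself follows by differentiating I(n, n) = 1 along the unit normal n. *)

theory Submission
  imports Defs
begin

section \<open>Unit vector fields in hyperbolic space\<close>

text \<open>In the half-space model a field of unit length satisfies the Euclidean equation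
  \<open>X y \<bullet> X y = (y$3)\<^sup>2\<close>; its derivative at \<open>x\<close> is cancelled
  by the Christoffel term. The metric is conformal to the Euclidean one, so the dot product in the
  conclusion expresses hyperbolic orthogonality.\<close>

lemma hyp_covariant_unit_field:
  assumes S: "open S" "x \<in> S" "S \<subseteq> hyp_space"
    and X: "X differentiable (at x)"
    and unit: "\<And>y. y \<in> S \<Longrightarrow> hyp_metric y (X y) (X y) = 1"
  shows "hyp_covariant X x u \<bullet> X x = 0"
proof -
  have x: "x$3 > 0"
    using S by (auto simp: hyp_space_def)
  have sq: "X y \<bullet> X y = (y$3)\<^sup>2" if "y \<in> S" for y
    using unit[OF that] that S(3) by (auto simp: hyp_metric_def hyp_space_def divide_eq_1_iff)
  let ?D = "frechet_derivative X (at x)"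
  have "(X has_derivative ?D) (at x)"
    using X frechet_derivative_works by blast
  then have "((\<lambda>y. X y \<bullet> X y) has_derivative (\<lambda>v. X x \<bullet> ?D v + ?D v \<bullet> X x)) (at x)"
    by (intro has_derivative_inner)
  then have deriv: "((\<lambda>y. (y$3)\<^sup>2) has_derivative (\<lambda>v. X x \<bullet> ?D v + ?D v \<bullet> X x)) (at x)"
    by (rule has_derivative_transform_within_open[OF _ S(1,2)]) (simp add: sq)
  have "((\<lambda>y. y$3) has_derivative (\<lambda>v. v$3)) (at x)"
    by (rule bounded_linear_imp_has_derivative[OF bounded_linear_vec_nth])
  then have "((\<lambda>y. (y$3)\<^sup>2) has_derivative (\<lambda>v. 2 * x$3 * v$3)) (at x)"
    by (auto intro!: derivative_eq_intros)
  from fun_cong[OF has_derivative_unique[OF deriv this], of u]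
  have "X x \<bullet> ?D u + ?D u \<bullet> X x = 2 * x$3 * u$3" .
  then have "?D u \<bullet> X x = x$3 * u$3"
    by (simp add: inner_commute)
  \<comment> \<open>Paired with \<open>X x\<close>, the last two Christoffel terms cancel and the
    first gives \<open>- x$3 * u$3\<close>.\<close>
  then show ?thesis
    using x sq[OF S(2)]
    by (simp add: hyp_covariant_def hyp_christoffel_def inner_add_left inner_diff_left
        inner_axis' field_simps power2_eq_square)
qed


section \<open>Gradients and unit normals\<close>

text \<open>An explicit stand-in for \<open>hyp_gradient\<close>, which is given by
  \<open>THE\<close>: a finite sum of partial derivatives can itself be differentiated in
  \<open>x\<close>.\<close>

definition euclidean_gradient :: "(real^3 \<Rightarrow> real) \<Rightarrow> real^3 \<Rightarrow> real^3" where
  "euclidean_gradient f x = (\<Sum>b\<in>Basis. frechet_derivative f (at x) b *\<^sub>R b)"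

lemma euclidean_gradient_inner:
  assumes "f differentiable (at x)"
  shows "frechet_derivative f (at x) v = euclidean_gradient f x \<bullet> v"
proof -
  have lin: "linear (frechet_derivative f (at x))"
    using assms by (rule linear_frechet_derivative)
  have "frechet_derivative f (at x) v = frechet_derivative f (at x) (\<Sum>b\<in>Basis. (v \<bullet> b) *\<^sub>R b)"
    by (simp add: euclidean_representation)
  also have "\<dots> = (\<Sum>b\<in>Basis. (v \<bullet> b) * frechet_derivative f (at x) b)"
    by (simp add: linear_sum[OF lin] linear_cmul[OF lin])
  finally show ?thesis
    by (simp add: euclidean_gradient_def inner_sum_left inner_sum_right inner_commute mult.commute)
qed

lemma hyp_gradient_eq:
  assumes "f differentiable (at x)" and "x \<in> hyp_space"
  shows "hyp_gradient f x = (x$3)\<^sup>2 *\<^sub>R euclidean_gradient f x"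
  unfolding hyp_gradient_def
proof (rule the_equality)
  have x: "x$3 > 0" using assms by (simp add: hyp_space_def)
  then show "\<forall>v. hyp_metric x ((x$3)\<^sup>2 *\<^sub>R euclidean_gradient f x) v = frechet_derivative f (at x) v"
    by (simp add: hyp_metric_def euclidean_gradient_inner[OF assms(1)])
  fix w assume w: "\<forall>v. hyp_metric x w v = frechet_derivative f (at x) v"
  have "w \<bullet> v = ((x$3)\<^sup>2 *\<^sub>R euclidean_gradient f x) \<bullet> v" for v
    using w[rule_format, of v] x
    by (simp add: hyp_metric_def euclidean_gradient_inner[OF assms(1)] field_simps)
  then show "w = (x$3)\<^sup>2 *\<^sub>R euclidean_gradient f x"
    using vector_eq_rdot by blast
qed

lemma unit_normal_eq:
  assumes f: "defining_function \<A> N p differentiable (at y)" and y: "y \<in> hyp_space"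
  shows "unit_normal \<A> N p y =
    (y$3 / norm (euclidean_gradient (defining_function \<A> N p) y)) *\<^sub>R
      euclidean_gradient (defining_function \<A> N p) y"
proof -
  let ?g = "euclidean_gradient (defining_function \<A> N p) y"
  have y3: "y$3 > 0" using y by (simp add: hyp_space_def)
  have "hyp_metric y ((y$3)\<^sup>2 *\<^sub>R ?g) ((y$3)\<^sup>2 *\<^sub>R ?g) = (y$3 * norm ?g)\<^sup>2"
    using y3 by (simp add: hyp_metric_def power_mult_distrib power2_norm_eq_inner[symmetric]
        power2_eq_square)
  \<comment> \<open>Where \<open>?g\<close> vanishes, both sides are 0.\<close>
  then show ?thesis
    using y3 by (simp add: unit_normal_def hyp_gradient_eq[OF f y] Let_def power2_eq_square)
qed

text \<open>The gradient uses up one of the two derivatives of \<open>f\<close>; the shape operator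
  will take the other.\<close>

lemma euclidean_gradient_differentiable:
  assumes "Ck_on 2 f S" "open S" "x \<in> S"
  shows "euclidean_gradient f differentiable (at x)"
proof -
  have "(\<lambda>y. frechet_derivative f (at y) b) differentiable (at x)" for b
    using assms by (simp add: numeral_2_eq_2 differentiable_on_eq_differentiable_at)
  then show ?thesis
    unfolding euclidean_gradient_def[abs_def] by (intro differentiable_sum differentiable_scaleR) auto
qed


section \<open>Geometry at a boundary point\<close>

text \<open>Some description exists at every frontier point, so the one picked by
  \<open>SOME\<close> is genuine. The geometry below reaches the chosen description only through
  this rule.\<close>

lemma chosen_descriptionE:
  assumes M: "hyperbolic_3_manifold M \<A>" and N: "compact_smooth_domain M \<A> N"
    and p: "p \<in> frontier N"
  obtains Q where "open Q" "boundary_position \<A> N p \<in> Q" "Q \<subseteq> hyp_space"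
    "smooth_on Q (defining_function \<A> N p)"
    "\<forall>y\<in>Q. defining_function \<A> N p differentiable (at y)"
    "\<forall>y\<in>Q. euclidean_gradient (defining_function \<A> N p) y \<noteq> 0"
proof -
  obtain U \<phi> Q f where d: "chosen_description \<A> N p = (U, \<phi>, Q, f)"
    using prod_cases4 by blast
  have "boundary_description \<A> N p (chosen_description \<A> N p)"
    using N p unfolding chosen_description_def compact_smooth_domain_def by (metis someI_ex)
  then have bd: "(U, \<phi>) \<in> \<A>" "open Q" "\<phi> p \<in> Q" "Q \<subseteq> \<phi> ` U" "smooth_on Q f"
    "\<And>x. x \<in> Q \<Longrightarrow> \<exists>v. frechet_derivative f (at x) v \<noteq> 0"
    by (auto simp: d)
  have "\<phi> ` U \<subseteq> hyp_space"
    using M bd(1) unfolding hyperbolic_3_manifold_def by blast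
  moreover have diff: "f differentiable (at y)" if "y \<in> Q" for y
  proof -
    have "Ck_on (Suc 0) f Q"
      using bd(5) unfolding smooth_on_def by blast
    then show ?thesis
      using that bd(2) by (simp add: differentiable_on_eq_differentiable_at)
  qed
  moreover have "euclidean_gradient f y \<noteq> 0" if "y \<in> Q" for y
    using bd(6)[OF that] euclidean_gradient_inner[OF diff[OF that]] by auto
  ultimately show thesis
    using bd by (intro that[of Q]) (auto simp: boundary_position_def defining_function_def d)
qed

context
  fixes M N :: "'m::{t2_space,second_countable_topology} set"
    and \<A> :: "'m hyp_chart set" and p :: 'm
  assumes M: "hyperbolic_3_manifold M \<A>"
    and N: "compact_smooth_domain M \<A> N"
    and p: "p \<in> frontier N"
begin

lemma boundary_tangent_eq:
  "boundary_tangent \<A> N p =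
    {u. euclidean_gradient (defining_function \<A> N p) (boundary_position \<A> N p) \<bullet> u = 0}"
  by (rule chosen_descriptionE[OF M N p])
    (simp add: boundary_tangent_def euclidean_gradient_inner)

lemma subspace_boundary_tangent: "subspace (boundary_tangent \<A> N p)"
  by (simp add: boundary_tangent_eq subspace_hyperplane)

text \<open>A hyperplane of 3-space with nonzero normal; the value 2 is what makes the final traces
  cancel.\<close>

lemma dim_boundary_tangent: "dim (boundary_tangent \<A> N p) = 2"
  by (rule chosen_descriptionE[OF M N p]) (simp add: boundary_tangent_eq dim_hyperplane)

text \<open>The normalized gradient has unit length on all of \<open>Q\<close>, not just on the
  boundary, so its covariant derivative in any direction is orthogonal to it.\<close>

lemma shape_operator_tangent: "shape_operator \<A> N p u \<in> boundary_tangent \<A> N p"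
proof -
  let ?f = "defining_function \<A> N p" and ?x = "boundary_position \<A> N p"
  let ?g = "euclidean_gradient ?f" and ?n = "unit_normal \<A> N p"
  obtain Q where Q: "open Q" "?x \<in> Q" "Q \<subseteq> hyp_space" "smooth_on Q ?f"
    and diff: "\<forall>y\<in>Q. ?f differentiable (at y)"
    and nz: "\<forall>y\<in>Q. ?g y \<noteq> 0"
    by (rule chosen_descriptionE[OF M N p])
  have pos: "y$3 > 0" if "y \<in> Q" for y
    using that Q(3) by (auto simp: hyp_space_def)
  have n: "?n y = (y$3 / norm (?g y)) *\<^sub>R ?g y" if "y \<in> Q" for y
    using that diff Q(3) by (intro unit_normal_eq) auto
  have "hyp_metric y (?n y) (?n y) = 1" if "y \<in> Q" for y
    using pos[OF that] bspec[OF nz that]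
    by (simp add: n[OF that] hyp_metric_def power2_norm_eq_inner[symmetric] power2_eq_square)
  moreover have "?n differentiable (at ?x)"
  proof -
    have g: "?g differentiable (at ?x)"
      using Q by (intro euclidean_gradient_differentiable[of _ Q]) (auto simp: smooth_on_def)
    \<comment> \<open>The norm is differentiable only away from 0, hence the appeal to
      \<open>nz\<close>.\<close>
    have "(\<lambda>y. norm (?g y)) differentiable (at ?x)"
      using differentiable_compose[of norm ?g] differentiable_norm_at[OF bspec[OF nz Q(2)]] g
      by auto
    moreover have "(\<lambda>y::real^3. y$3) differentiable (at ?x)"
      by (intro bounded_linear_imp_differentiable bounded_linear_vec_nth)
    ultimately have "(\<lambda>y. (y$3 / norm (?g y)) *\<^sub>R ?g y) differentiable (at ?x)"
      using g bspec[OF nz Q(2)] by (intro differentiable_scaleR differentiable_divide) auto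
    \<comment> \<open>The formula \<open>n\<close> is known on \<open>Q\<close> only; openness of
      \<open>Q\<close> transfers the derivative.\<close>
    then show ?thesis
      unfolding differentiable_def
      by (metis (no_types, lifting) Q(1,2) n has_derivative_transform_within_open)
  qed
  ultimately have "shape_operator \<A> N p u \<bullet> ?n ?x = 0"
    unfolding shape_operator_def by (intro hyp_covariant_unit_field[OF Q(1-3)]) auto
  \<comment> \<open>At \<open>?x\<close> the normal is a positive multiple of \<open>?g ?x\<close>,
    so orthogonality to it is tangency.\<close>
  then show ?thesis
    using pos[OF Q(2)] bspec[OF nz Q(2)] by (simp add: n[OF Q(2)] boundary_tangent_eq inner_commute)
qed

text \<open>Uniqueness holds because the first form is positive definite: two candidates are
  compared on their difference, which is again tangent.\<close>

lemma form_endo_eqI: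
  assumes z: "z \<in> boundary_tangent \<A> N p"
    and A: "\<And>v. v \<in> boundary_tangent \<A> N p \<Longrightarrow> A u v = first_form \<A> N p z v"
  shows "form_endo \<A> N p A u = z"
  unfolding form_endo_def
proof (rule the_equality)
  show "z \<in> boundary_tangent \<A> N p \<and> (\<forall>v\<in>boundary_tangent \<A> N p. A u v = first_form \<A> N p z v)"
    using assms by blast
next
  fix w
  assume w: "w \<in> boundary_tangent \<A> N p \<and>
    (\<forall>v\<in>boundary_tangent \<A> N p. A u v = first_form \<A> N p w v)"
  then have "w - z \<in> boundary_tangent \<A> N p"
    using z subspace_boundary_tangent by (simp add: subspace_diff)
  then have "first_form \<A> N p w (w - z) = first_form \<A> N p z (w - z)"
    using w A by simp
  moreover obtain Q where "boundary_position \<A> N p \<in> Q" "Q \<subseteq> hyp_space"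
    by (rule chosen_descriptionE[OF M N p])
  then have "boundary_position \<A> N p $ 3 > 0"
    by (auto simp: hyp_space_def)
  ultimately have "(w - z) \<bullet> (w - z) = 0"
    by (simp add: first_form_def hyp_metric_def inner_diff_left)
  then show "w = z"
    by simp
qed

lemma form_endo_first_form:
  "u \<in> boundary_tangent \<A> N p \<Longrightarrow> form_endo \<A> N p (first_form \<A> N p) u = u"
  by (rule form_endo_eqI) simp_all

lemma form_endo_momentum_form:
  assumes "u \<in> boundary_tangent \<A> N p"
  shows "form_endo \<A> N p (momentum_form \<A> N p) u =
    (- 1/4) *\<^sub>R (shape_operator \<A> N p u - (mean_curvature \<A> N p / 2) *\<^sub>R u)"
proof (rule form_endo_eqI)
  show "(- 1/4) *\<^sub>R (shape_operator \<A> N p u - (mean_curvature \<A> N p / 2) *\<^sub>R u)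
      \<in> boundary_tangent \<A> N p"
    using assms shape_operator_tangent subspace_boundary_tangent
    by (intro subspace_scale subspace_diff) auto
qed (simp add: momentum_form_def second_form_def first_form_def hyp_metric_def
    inner_diff_left diff_divide_distrib)

lemma form_inner_momentum_first: "form_inner \<A> N p (momentum_form \<A> N p) (first_form \<A> N p) = 0"
proof -
  let ?T = "boundary_tangent \<A> N p" and ?B = "shape_operator \<A> N p"
    and ?H = "mean_curvature \<A> N p"
  \<comment> \<open>This is the very basis that \<open>trace_on\<close> picks for the tangent plane,
    so the trace in \<open>form_inner\<close> and the one in \<open>mean_curvature\<close> can be
    compared term by term.\<close>
  define E where "E = (SOME E. independent E \<and> span E = ?T)"
  have "\<exists>E. independent E \<and> span E = ?T"
    using subspace_boundary_tangent
    by (metis basis_exists span_minimal subset_antisym)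
  then have E: "independent E" "span E = ?T"
    unfolding E_def by (metis (mono_tags, lifting) someI_ex)+
  have card: "card E = 2"
    using E dim_boundary_tangent by (metis dim_span dim_eq_card_independent)
  have in_T: "e \<in> ?T" if "e \<in> E" for e
    using that E(2) span_superset by blast
  have "representation E ((form_endo \<A> N p (momentum_form \<A> N p) \<circ>
          form_endo \<A> N p (first_form \<A> N p)) e) e
      = (- 1/4) * (representation E (?B e) e - ?H / 2)" if "e \<in> E" for e
  proof -
    \<comment> \<open>\<open>representation\<close> is linear only on the span of the basis, which
      is where tangency of \<open>?B e\<close> enters.\<close>
    have "?B e \<in> span E" "e \<in> span E" "(?H / 2) *\<^sub>R e \<in> span E"
      "?B e - (?H / 2) *\<^sub>R e \<in> span E"
      using that E(2) shape_operator_tangent[of e] span_base[OF that]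
      by (auto intro: span_scale span_diff)
    then have "representation E ((- 1/4) *\<^sub>R (?B e - (?H / 2) *\<^sub>R e)) e
        = (- 1/4) * (representation E (?B e) e - ?H / 2 * representation E e e)"
      by (simp add: real_vector.representation_scale[OF E(1)]
          real_vector.representation_diff[OF E(1)] del: scaleR_minus_left)
    then show ?thesis
      using that E(1) in_T
      by (simp add: form_endo_first_form form_endo_momentum_form representation_basis)
  qed
  then have "form_inner \<A> N p (momentum_form \<A> N p) (first_form \<A> N p)
      = (\<Sum>e\<in>E. (- 1/4) * (representation E (?B e) e - ?H / 2))"
    unfolding form_inner_def trace_on_def E_def[symmetric] Let_def by (intro sum.cong) auto
  also have "\<dots> = (- 1/4) * ((\<Sum>e\<in>E. representation E (?B e) e) - card E * (?H / 2))"
    by (simp only: sum_distrib_left[symmetric] sum_subtractf sum_constant of_nat_id)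
  also have "(\<Sum>e\<in>E. representation E (?B e) e) = ?H"
    by (simp add: mean_curvature_def trace_on_def E_def[symmetric] Let_def)
  \<comment> \<open>Each of the two basis vectors contributes \<open>?H / 2\<close>, which together
    cancel the trace \<open>?H\<close>.\<close>
  finally show ?thesis
    by (simp add: card)
qed

end

theorem mainTheorem5:
  fixes M N :: "'m::{t2_space,second_countable_topology} set"
    and \<A> :: "'m hyp_chart set"
  assumes "hyperbolic_3_manifold M \<A>"
    and "compact_smooth_domain M \<A> N"
  shows "dual_W_volume M \<A> N = W_volume M \<A> N"
proof -
  have "(\<lambda>p. indicator (frontier N) p *\<^sub>R
      form_inner \<A> N p (momentum_form \<A> N p) (first_form \<A> N p)) = (\<lambda>p. 0)"
    using form_inner_momentum_first[OF assms] by (auto simp: indicator_def)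
  then show ?thesis
    by (simp add: dual_W_volume_def set_lebesgue_integral_def)
qed

end
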